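(* Let $X$ be a finite connected poset and $K$ a field with $\mathrm{char}(K)\neq 2$. Then a map $\varphi:FI(X,K)\to FI(X,K)$ is a bijective linear inverse preserver if and only if one of $\varphi$, $-\varphi$ is an automorphism of $FI(X,K)$ or an anti-automorphism of $FI(X,K)$.
   Context: For a finite poset $(X,\le)$ and a field $K$, the finitary incidence algebra $FI(X,K)$ is the ordinary incidence algebra: the $K$-space of sums $\alpha=\sum_{x\le y}\alpha_{xy}e_{xy}$ ($x,y\in X$, $\alpha_{xy}\in K$) with product $\alpha\beta=\sum_{x\le y}\big(\sum_{x\le z\le y}\alpha_{xz}\beta_{zy}\big)e_{xy}$ and identity $\delta=\sum_{x\in X}e_{xx}$. A poset is connected if any two of its elements can be joined by a finite sequence of elements in which consecutive ones are comparable. For a unital associative algebra $A$ with group of units $U(A)$, a map $\varphi:A\to A$ is an inverse preserver if $\varphi(U(A))\subseteq U(A)$ and $\varphi(a^{-1})=\varphi(a)^{-1}$ for all $a\in U(A)$. Linear means $K$-linear; automorphisms and anti-automorphisms are those of $K$-algebras (in particular $K$-linear and bijective). *)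

theory Defs
  imports "HOL-Algebra.Module" "HOL-Algebra.QuotRing"
begin

text \<open>
  A poset is a carrier \<open>X\<close> with its order relation \<open>r\<close>, where \<open>(x, y) \<in> r\<close> means \<open>x \<le> y\<close>;
  \<open>partial_order_on X r\<close> includes \<open>r \<subseteq> X \<times> X\<close>, so the sequences below stay inside \<open>X\<close>.
  The empty poset counts as connected.
\<close>

definition connected_poset :: "'a set \<Rightarrow> 'a rel \<Rightarrow> bool" where
  "connected_poset X r \<longleftrightarrow>
     partial_order_on X r \<and> (\<forall>x\<in>X. \<forall>y\<in>X. (x, y) \<in> (r \<union> r\<inverse>)\<^sup>*)"

text \<open>
  The sum of all \<open>\<alpha>\<^sub>x\<^sub>y e\<^sub>x\<^sub>y\<close> with \<open>x \<le> y\<close> is represented by its coefficient function, extended by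
  \<open>0\<close> outside \<open>r\<close>.  The ring record is extended by the scalar multiplication; the scalars form
  a whole type.
\<close>

definition incidence_algebra :: "'a set \<Rightarrow> 'a rel \<Rightarrow> ('k::field, 'a \<Rightarrow> 'a \<Rightarrow> 'k) module" where
  "incidence_algebra X r =
     \<lparr>carrier = {\<alpha>. \<forall>x y. (x, y) \<notin> r \<longrightarrow> \<alpha> x y = 0},
      mult = (\<lambda>\<alpha> \<beta> x y. if (x, y) \<in> r
                then \<Sum>z | (x, z) \<in> r \<and> (z, y) \<in> r. \<alpha> x z * \<beta> z y else 0),
      one = (\<lambda>x y. if x \<in> X \<and> x = y then 1 else 0),
      zero = (\<lambda>x y. 0),
      add = (\<lambda>\<alpha> \<beta> x y. \<alpha> x y + \<beta> x y),
      smult = (\<lambda>c \<alpha> x y. c * \<alpha> x y)\<rparr>"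

definition linear_endo :: "('k, 'v, 'm) module_scheme \<Rightarrow> ('v \<Rightarrow> 'v) \<Rightarrow> bool" where
  "linear_endo A \<phi> \<longleftrightarrow>
     \<phi> \<in> carrier A \<rightarrow> carrier A \<and>
     (\<forall>a\<in>carrier A. \<forall>b\<in>carrier A. \<phi> (a \<oplus>\<^bsub>A\<^esub> b) = \<phi> a \<oplus>\<^bsub>A\<^esub> \<phi> b) \<and>
     (\<forall>c. \<forall>a\<in>carrier A. \<phi> (c \<odot>\<^bsub>A\<^esub> a) = c \<odot>\<^bsub>A\<^esub> \<phi> a)"

definition inverse_preserver :: "('v, 'm) ring_scheme \<Rightarrow> ('v \<Rightarrow> 'v) \<Rightarrow> bool" where
  "inverse_preserver A \<phi> \<longleftrightarrow>
     \<phi> \<in> carrier A \<rightarrow> carrier A \<and>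
     \<phi> ` Units A \<subseteq> Units A \<and>
     (\<forall>a\<in>Units A. \<phi> (inv\<^bsub>A\<^esub> a) = inv\<^bsub>A\<^esub> (\<phi> a))"

definition algebra_automorphism :: "('k, 'v, 'm) module_scheme \<Rightarrow> ('v \<Rightarrow> 'v) \<Rightarrow> bool" where
  "algebra_automorphism A \<phi> \<longleftrightarrow> linear_endo A \<phi> \<and> \<phi> \<in> ring_iso A A"

definition algebra_antiautomorphism :: "('k, 'v, 'm) module_scheme \<Rightarrow> ('v \<Rightarrow> 'v) \<Rightarrow> bool" where
  "algebra_antiautomorphism A \<phi> \<longleftrightarrow>
     linear_endo A \<phi> \<and> bij_betw \<phi> (carrier A) (carrier A) \<and> \<phi> \<one>\<^bsub>A\<^esub> = \<one>\<^bsub>A\<^esub> \<and>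
     (\<forall>a\<in>carrier A. \<forall>b\<in>carrier A. \<phi> (a \<otimes>\<^bsub>A\<^esub> b) = \<phi> b \<otimes>\<^bsub>A\<^esub> \<phi> a)"

lemma incidence_algebra_ring:
  fixes X :: "'a set"
  assumes "finite X" and po: "partial_order_on X r"
  shows "ring (incidence_algebra X r :: ('k::field, 'a \<Rightarrow> 'a \<Rightarrow> 'k) module)" (is "ring ?A")
proof -
  have sub: "r \<subseteq> X \<times> X" and rf: "\<And>x. x \<in> X \<Longrightarrow> (x, x) \<in> r" and tr: "trans r"
    using partial_order_onD[OF po] by (auto simp: refl_on_def)
  have fin: "finite {z. (x, z) \<in> r \<and> P z}" for x P
    by (rule finite_subset[OF _ \<open>finite X\<close>]) (use sub in auto)
  have assoc: "(\<Sum>z | (x, z) \<in> r \<and> (z, y) \<in> r.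
        (if (x, z) \<in> r then \<Sum>w | (x, w) \<in> r \<and> (w, z) \<in> r. a x w * b w z else 0) * c z y) =
      (\<Sum>w | (x, w) \<in> r \<and> (w, y) \<in> r.
        a x w * (if (w, y) \<in> r then \<Sum>z | (w, z) \<in> r \<and> (z, y) \<in> r. b w z * c z y else 0))"
    for a b c :: "'a \<Rightarrow> 'a \<Rightarrow> 'k" and x y
  proof -
    have "(\<Sum>z | (x, z) \<in> r \<and> (z, y) \<in> r.
        (if (x, z) \<in> r then \<Sum>w | (x, w) \<in> r \<and> (w, z) \<in> r. a x w * b w z else 0) * c z y)
      = (\<Sum>z | (x, z) \<in> r \<and> (z, y) \<in> r.
          \<Sum>w | w \<in> {w. (x, w) \<in> r \<and> (w, y) \<in> r} \<and> (w, z) \<in> r. a x w * b w z * c z y)"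
      by (rule sum.cong) (auto simp: sum_distrib_right intro!: sum.cong dest: transD[OF tr])
    also have "\<dots> = (\<Sum>w | (x, w) \<in> r \<and> (w, y) \<in> r.
          \<Sum>z | z \<in> {z. (x, z) \<in> r \<and> (z, y) \<in> r} \<and> (w, z) \<in> r. a x w * b w z * c z y)"
      by (rule sum.swap_restrict) (auto simp: fin)
    also have "\<dots> = (\<Sum>w | (x, w) \<in> r \<and> (w, y) \<in> r.
        a x w * (if (w, y) \<in> r then \<Sum>z | (w, z) \<in> r \<and> (z, y) \<in> r. b w z * c z y else 0))"
      by (rule sum.cong)
        (auto simp: sum_distrib_left mult.assoc intro!: sum.cong dest: transD[OF tr])
    finally show ?thesis .
  qed
  have one_l: "(\<Sum>z | (x, z) \<in> r \<and> (z, y) \<in> r. (if x \<in> X \<and> x = z then 1 else 0) * a z y) = a x y"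
    if "(x, y) \<in> r" for a :: "'a \<Rightarrow> 'a \<Rightarrow> 'k" and x y
  proof -
    have "(\<Sum>z | (x, z) \<in> r \<and> (z, y) \<in> r. (if x \<in> X \<and> x = z then 1 else 0) * a z y) =
        (\<Sum>z | (x, z) \<in> r \<and> (z, y) \<in> r. if x = z then a z y else 0)"
      by (rule sum.cong) (use that sub in auto)
    then show ?thesis using that rf sub by (auto simp: sum.delta' fin)
  qed
  have one_r: "(\<Sum>z | (x, z) \<in> r \<and> (z, y) \<in> r. a x z * (if z \<in> X \<and> z = y then 1 else 0)) = a x y"
    if "(x, y) \<in> r" for a :: "'a \<Rightarrow> 'a \<Rightarrow> 'k" and x y
  proof -
    have "(\<Sum>z | (x, z) \<in> r \<and> (z, y) \<in> r. a x z * (if z \<in> X \<and> z = y then 1 else 0)) =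
        (\<Sum>z | (x, z) \<in> r \<and> (z, y) \<in> r. if z = y then a x z else 0)"
      by (rule sum.cong) (use that sub in auto)
    then show ?thesis using that rf sub by (auto simp: sum.delta fin)
  qed
  show ?thesis
  proof (rule ringI)
    show "abelian_group ?A"
    proof (rule abelian_groupI)
      fix a assume "a \<in> carrier ?A"
      then show "\<exists>b\<in>carrier ?A.
          b \<oplus>\<^bsub>?A\<^esub> a = \<zero>\<^bsub>?A\<^esub>"
        by (intro bexI[of _ "\<lambda>x y. - a x y"]) (auto simp: incidence_algebra_def)
    qed (auto simp: incidence_algebra_def algebra_simps)
    show "Group.monoid ?A"
    proof (rule monoidI)
      fix a b c
      show "a \<otimes>\<^bsub>?A\<^esub> b \<otimes>\<^bsub>?A\<^esub> c =
        a \<otimes>\<^bsub>?A\<^esub> (b \<otimes>\<^bsub>?A\<^esub> c)"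
        using assoc by (simp add: incidence_algebra_def fun_eq_iff)
    next
      fix a assume "a \<in> carrier ?A"
      then show "\<one>\<^bsub>?A\<^esub> \<otimes>\<^bsub>?A\<^esub> a = a"
        and "a \<otimes>\<^bsub>?A\<^esub> \<one>\<^bsub>?A\<^esub> = a"
        using one_l one_r by (simp_all add: incidence_algebra_def fun_eq_iff)
    qed (use rf in \<open>auto simp: incidence_algebra_def\<close>)
  qed (auto simp: incidence_algebra_def fun_eq_iff algebra_simps sum.distrib)
qed

lemma incidence_algebra_smult_assoc:
  "(c \<odot>\<^bsub>incidence_algebra X r\<^esub> a) \<otimes>\<^bsub>incidence_algebra X r\<^esub> b =
     c \<odot>\<^bsub>incidence_algebra X r\<^esub> (a \<otimes>\<^bsub>incidence_algebra X r\<^esub> b)"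
  "a \<otimes>\<^bsub>incidence_algebra X r\<^esub> (c \<odot>\<^bsub>incidence_algebra X r\<^esub> b) =
     c \<odot>\<^bsub>incidence_algebra X r\<^esub> (a \<otimes>\<^bsub>incidence_algebra X r\<^esub> b)"
  by (auto simp: incidence_algebra_def fun_eq_iff sum_distrib_left mult_ac)

end

theory Submission
  imports Defs "HOL-Library.Function_Algebras"
begin

text \<open>
  Put \<open>v = \<phi> 1\<close>.  Applying \<open>\<phi>\<close> to \<open>(1 - 2 e)\<^sup>2 = 1\<close> for idempotents \<open>e\<close>, and to \<open>(1 + n) (1 - n) = 1\<close>
  for \<open>n\<^sup>2 = 0\<close>, gives \<open>2 (\<phi> e)\<^sup>2 = v \<phi> e + \<phi> e v\<close>, \<open>(\<phi> n)\<^sup>2 = 0\<close> and \<open>v \<phi> n = \<phi> n v\<close>; no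
  further scalars are needed, so small fields cause no trouble.  Comparing diagonals, \<open>\<phi>\<close> maps the
  radical onto itself, hence \<open>v\<close> commutes with the radical; connectedness and \<open>v\<^sup>2 = 1\<close> force
  \<open>v = \<plusminus>1\<close>, and we may assume \<open>v = 1\<close>.

  Now \<open>\<phi>\<close> preserves idempotents.  With \<open>g\<^sub>x = \<phi> e\<^sub>x\<^sub>x\<close>, the Peirce decomposition with respect to these
  orthogonal idempotents gives \<open>\<phi> e\<^sub>x\<^sub>y = g\<^sub>x \<phi> e\<^sub>x\<^sub>y g\<^sub>y + g\<^sub>y \<phi> e\<^sub>x\<^sub>y g\<^sub>x\<close> for \<open>x < y\<close>, and surjectivity
  leaves only one of the two summands.  Edges \<open>x < y\<close> of the poset sharing a vertex keep the same
  summand, so by connectedness all of them do, and \<open>\<phi>\<close> is multiplicative or anti-multiplicative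
  on the basis.
\<close>

lemma sum_fun_apply: "(\<Sum>i\<in>I. f i) x = (\<Sum>i\<in>I. f i x)"
  by (induction I rule: infinite_finite_induct) auto

text \<open>As simp rules these would turn a sum of functions under a binder into a \<open>\<lambda>\<close>-abstraction.\<close>

declare plus_fun_apply [simp del] zero_fun_apply [simp del]

lemmas pointwise = fun_eq_iff plus_fun_apply zero_fun_apply

section \<open>The incidence algebra\<close>

locale finite_poset =
  fixes X :: "'a set" and r :: "'a rel"
  assumes finite_X: "finite X" and po: "partial_order_on X r"
begin

lemma r_X: "(x, y) \<in> r \<Longrightarrow> x \<in> X" "(x, y) \<in> r \<Longrightarrow> y \<in> X"
  and r_refl: "x \<in> X \<Longrightarrow> (x, x) \<in> r"
  and r_trans: "(x, y) \<in> r \<Longrightarrow> (y, z) \<in> r \<Longrightarrow> (x, z) \<in> r"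
  and r_antisym: "(x, y) \<in> r \<Longrightarrow> (y, x) \<in> r \<Longrightarrow> x = y"
  using partial_order_onD[OF po] by (auto simp: refl_on_def dest: transD antisymD)

lemma finite_r: "finite r"
  by (rule finite_subset[of r "X \<times> X"]) (use finite_X r_X in auto)

lemma finite_interval [simp]: "finite {z. (x, z) \<in> r \<and> (z, y) \<in> r}"
  by (rule finite_subset[OF _ finite_X]) (use r_X in auto)

definition carr :: "('a \<Rightarrow> 'a \<Rightarrow> 'k::field) set" where
  "carr = {\<alpha>. \<forall>x y. (x, y) \<notin> r \<longrightarrow> \<alpha> x y = 0}"

definition mul :: "('a \<Rightarrow> 'a \<Rightarrow> 'k::field) \<Rightarrow> ('a \<Rightarrow> 'a \<Rightarrow> 'k) \<Rightarrow> 'a \<Rightarrow> 'a \<Rightarrow> 'k" (infixl "\<star>" 70) where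
  "\<alpha> \<star> \<beta> = (\<lambda>x y. if (x, y) \<in> r then \<Sum>z | (x, z) \<in> r \<and> (z, y) \<in> r. \<alpha> x z * \<beta> z y else 0)"

definition delta :: "'a \<Rightarrow> 'a \<Rightarrow> 'k::field" where
  "delta = (\<lambda>x y. if x \<in> X \<and> x = y then 1 else 0)"

definition smul :: "'k::field \<Rightarrow> ('a \<Rightarrow> 'a \<Rightarrow> 'k) \<Rightarrow> 'a \<Rightarrow> 'a \<Rightarrow> 'k" where
  "smul c \<alpha> = (\<lambda>x y. c * \<alpha> x y)"

definition E :: "'a \<Rightarrow> 'a \<Rightarrow> 'a \<Rightarrow> 'a \<Rightarrow> 'k::field" where
  "E x y = (\<lambda>u v. if u = x \<and> v = y then 1 else 0)"

lemma incidence_algebra_simps: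
  "carrier (incidence_algebra X r) = carr"
  "mult (incidence_algebra X r) = mul"
  "one (incidence_algebra X r) = delta"
  "zero (incidence_algebra X r) = 0"
  "add (incidence_algebra X r) = (+)"
  "Module.smult (incidence_algebra X r) = smul"
  by (simp_all add: incidence_algebra_def carr_def mul_def delta_def smul_def pointwise)

lemma carrD: "a \<in> carr \<Longrightarrow> (x, y) \<notin> r \<Longrightarrow> a x y = 0"
  by (simp add: carr_def)

lemma carr_closed [simp]:
  "0 \<in> carr"
  "delta \<in> carr"
  "a \<star> b \<in> carr"
  "a \<in> carr \<Longrightarrow> b \<in> carr \<Longrightarrow> a + b \<in> carr"
  "a \<in> carr \<Longrightarrow> b \<in> carr \<Longrightarrow> a - b \<in> carr"
  "a \<in> carr \<Longrightarrow> - a \<in> carr"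
  "a \<in> carr \<Longrightarrow> smul c a \<in> carr"
  "(x, y) \<in> r \<Longrightarrow> E x y \<in> carr"
  by (auto simp: pointwise carr_def delta_def mul_def smul_def E_def intro: r_refl)

lemma mul_bilinear:
  "(a + b) \<star> c = a \<star> c + b \<star> c"
  "c \<star> (a + b) = c \<star> a + c \<star> b"
  "(a - b) \<star> c = a \<star> c - b \<star> c"
  "c \<star> (a - b) = c \<star> a - c \<star> b"
  "(- a) \<star> b = - (a \<star> b)"
  "a \<star> (- b) = - (a \<star> b)"
  "0 \<star> a = 0"
  "a \<star> 0 = 0"
  "smul k a \<star> b = smul k (a \<star> b)"
  "a \<star> smul k b = smul k (a \<star> b)"
  by (auto simp: mul_def smul_def pointwise algebra_simps sum.distrib sum_subtractf sum_negf
      sum_distrib_left)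

text \<open>The product reads only the entries over \<open>r\<close>, so truncating all three
  factors by \<open>t\<close> moves the identity into the carrier, where it is associativity in the
  ring.\<close>

lemma mul_assoc: "a \<star> b \<star> c = a \<star> (b \<star> (c :: 'a \<Rightarrow> 'a \<Rightarrow> 'k::field))"
proof -
  interpret A: ring "incidence_algebra X r :: ('k, 'a \<Rightarrow> 'a \<Rightarrow> 'k) module"
    by (rule incidence_algebra_ring[OF finite_X po])
  define t where "t a = (\<lambda>x y. if (x, y) \<in> r then a x y else 0)" for a :: "'a \<Rightarrow> 'a \<Rightarrow> 'k"
  have t: "t a \<in> carr" for a
    by (simp add: t_def carr_def)
  have mul_t: "a \<star> b = t a \<star> t b" for a b
    by (auto simp: mul_def t_def pointwise intro!: sum.cong)
  have "t (a \<star> b) = a \<star> b" for a b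
    by (auto simp: t_def mul_def pointwise)
  then have "a \<star> b \<star> c = t a \<star> t b \<star> t c" "a \<star> (b \<star> c) = t a \<star> (t b \<star> t c)"
    by (simp_all only: mul_t[of a b] mul_t[of b c] mul_t[of "t a \<star> t b" c] mul_t[of a "t b \<star> t c"])
  then show ?thesis
    using A.m_assoc[of "t a" "t b" "t c"] t by (simp add: incidence_algebra_simps)
qed

lemma delta_mul [simp]:
  assumes "a \<in> carr"
  shows "delta \<star> a = a" "a \<star> delta = (a :: 'a \<Rightarrow> 'a \<Rightarrow> 'k::field)"
proof -
  interpret A: ring "incidence_algebra X r :: ('k, 'a \<Rightarrow> 'a \<Rightarrow> 'k) module"
    by (rule incidence_algebra_ring[OF finite_X po])
  show "delta \<star> a = a" "a \<star> delta = a"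
    using A.l_one[of a] A.r_one[of a] assms by (simp_all add: incidence_algebra_simps)
qed

lemma smul_simps:
  "smul c (a + b) = smul c a + smul c b"
  "smul c (a - b) = smul c a - smul c b"
  "smul (c + d) a = smul c a + smul d a"
  "smul c (smul d a) = smul (c * d) a"
  "smul 1 a = a"
  "smul 0 a = 0"
  "smul c 0 = 0"
  "smul c (- a) = - smul c a"
  "smul (- c) a = - smul c a"
  by (simp_all add: smul_def pointwise algebra_simps)

lemma smul_eq_0_iff: "smul c a = 0 \<longleftrightarrow> c = 0 \<or> a = 0"
  by (auto simp: smul_def pointwise)

text \<open>Every element is the finite sum of its terms \<open>smul c (E x y)\<close> over
  \<open>r\<close>. This reduces linear claims to matrix units.\<close>

lemma carr_induct [consumes 1, case_names zero add E]:
  fixes a :: "'a \<Rightarrow> 'a \<Rightarrow> 'k::field"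
  assumes a: "a \<in> carr" and zero: "P 0"
    and add: "\<And>a b. a \<in> carr \<Longrightarrow> b \<in> carr \<Longrightarrow> P a \<Longrightarrow> P b \<Longrightarrow> P (a + b)"
    and E: "\<And>c x y. (x, y) \<in> r \<Longrightarrow> P (smul c (E x y))"
  shows "P a"
proof -
  define T where "T p = smul (a (fst p) (snd p)) (E (fst p) (snd p))" for p
  have "P (sum T S) \<and> sum T S \<in> carr" if "finite S" "S \<subseteq> r" for S
    using that
  proof (induction S)
    case (insert p S)
    have "P (T p)" "T p \<in> carr"
      using insert.prems by (cases p, auto simp: T_def intro: E)+
    then show ?case
      using insert.IH insert.prems add unfolding sum.insert[OF insert.hyps]
      by simp
  qed (simp add: zero)
  from this[OF finite_r order_refl] have "P (sum T r)" ..
  also have "sum T r = a"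
  proof (intro ext)
    fix u v
    have "sum T r u v = (\<Sum>p\<in>r. if (u, v) = p then a u v else 0)"
      by (auto simp: sum_fun_apply T_def smul_def E_def intro!: sum.cong)
    also have "\<dots> = a u v"
      using a by (simp add: finite_r carrD)
    finally show "sum T r u v = a u v" .
  qed
  finally show ?thesis .
qed

section \<open>Products with matrix units\<close>

lemma mul_E_right:
  assumes "a \<in> carr" "(s, t) \<in> r"
  shows "(a \<star> E s t) x y = (if y = t then a x s else 0)"
proof (cases "(x, y) \<in> r")
  case True
  have "(\<Sum>z | (x, z) \<in> r \<and> (z, y) \<in> r. a x z * E s t z y)
      = (\<Sum>z | (x, z) \<in> r \<and> (z, y) \<in> r. if z = s then (if y = t then a x s else 0) else 0)"
    by (intro sum.cong) (auto simp: E_def)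
  also have "\<dots> = (if y = t then a x s else 0)"
    using assms by (auto simp: carrD)
  finally show ?thesis using True by (simp add: mul_def)
next
  case False
  \<comment> \<open>Outside \<open>r\<close> the product is 0 by definition; transitivity makes
    \<open>a x s\<close> vanish too.\<close>
  then have "y = t \<Longrightarrow> (x, s) \<notin> r"
    using assms r_trans by blast
  then show ?thesis
    using False assms by (auto simp: mul_def carrD)
qed

lemma mul_E_left:
  assumes "a \<in> carr" "(s, t) \<in> r"
  shows "(E s t \<star> a) x y = (if x = s then a t y else 0)"
proof (cases "(x, y) \<in> r")
  case True
  have "(\<Sum>z | (x, z) \<in> r \<and> (z, y) \<in> r. E s t x z * a z y)
      = (\<Sum>z | (x, z) \<in> r \<and> (z, y) \<in> r. if z = t then (if x = s then a t y else 0) else 0)"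
    by (intro sum.cong) (auto simp: E_def)
  also have "\<dots> = (if x = s then a t y else 0)"
    using assms by (auto simp: carrD)
  finally show ?thesis using True by (simp add: mul_def)
next
  case False
  then have "x = s \<Longrightarrow> (t, y) \<notin> r"
    using assms r_trans by blast
  then show ?thesis
    using False assms by (auto simp: mul_def carrD)
qed

text \<open>A rank-one product: column \<open>s\<close> of \<open>a\<close> times row
  \<open>s\<close> of \<open>b\<close>. Hence it is nonzero as soon as that column and that row
  are.\<close>

lemma mul_E_mul:
  assumes "a \<in> carr" "b \<in> carr" "s \<in> X"
  shows "(a \<star> E s s \<star> b) x y = a x s * b s y"
proof (cases "(x, y) \<in> r")
  case True
  have "(a \<star> E s s \<star> b) x y = (\<Sum>z | (x, z) \<in> r \<and> (z, y) \<in> r. if z = s then a x s * b s y else 0)"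
    unfolding mul_def[of _ b] using True assms
    by (simp only: if_True) (intro sum.cong; simp add: mul_E_right r_refl)
  also have "\<dots> = a x s * b s y"
    using assms by (auto simp: carrD)
  finally show ?thesis .
next
  case False
  then have "(x, s) \<notin> r \<or> (s, y) \<notin> r"
    using r_trans by blast
  then show ?thesis
    using False assms by (auto simp: carrD)
qed

lemma mul_E_E:
  assumes "(x, y) \<in> r" "(u, v) \<in> r"
  shows "E x y \<star> E u v = (if y = u then E x v else 0)"
proof (intro ext)
  fix s t
  show "(E x y \<star> E u v) s t = (if y = u then E x v else 0) s t"
    unfolding mul_E_left[OF carr_closed(8)[OF assms(2)] assms(1)]
    by (simp add: E_def zero_fun_apply)
qed

lemma mul_diag: "x \<in> X \<Longrightarrow> (a \<star> b) x x = a x x * b x x"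
proof -
  assume x: "x \<in> X"
  have "{z. (x, z) \<in> r \<and> (z, x) \<in> r} = {x}"
    using x r_refl r_antisym by auto
  then show ?thesis using x r_refl by (simp add: mul_def)
qed

text \<open>Induction on the size of the interval from \<open>x\<close> to \<open>y\<close>. In
  \<open>(a \<star> a) x y\<close> the factor \<open>a x z\<close> with \<open>z \<noteq> y\<close>
  belongs to a smaller interval, and the term for \<open>z = y\<close> contains the diagonal entry
  \<open>a y y = 0\<close>.\<close>

lemma idempotent_zero_diag:
  assumes a: "a \<in> carr" "a \<star> a = a" and diag: "\<And>x. x \<in> X \<Longrightarrow> a x x = 0"
  shows "a = 0"
proof -
  have "a x y = 0" for x y
  proof (induction "card {z. (x, z) \<in> r \<and> (z, y) \<in> r}" arbitrary: x y rule: less_induct)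
    case less
    show ?case
    proof (cases "(x, y) \<in> r")
      case True
      have "a x z * a z y = 0" if z: "(x, z) \<in> r" "(z, y) \<in> r" for z
      proof (cases "z = y")
        case False
        have "{w. (x, w) \<in> r \<and> (w, z) \<in> r} \<subset> {w. (x, w) \<in> r \<and> (w, y) \<in> r}"
        proof (rule psubsetI)
          show "{w. (x, w) \<in> r \<and> (w, z) \<in> r} \<subseteq> {w. (x, w) \<in> r \<and> (w, y) \<in> r}"
            using r_trans[OF _ z(2)] by blast
          have "(y, z) \<notin> r" "(y, y) \<in> r"
            using z False r_antisym r_refl r_X by blast+
          then show "{w. (x, w) \<in> r \<and> (w, z) \<in> r} \<noteq> {w. (x, w) \<in> r \<and> (w, y) \<in> r}"
            using True by blast
        qed
        then have "a x z = 0"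
          by (intro less psubset_card_mono) auto
        then show ?thesis by simp
      qed (use diag True r_X in auto)
      then have "(a \<star> a) x y = 0"
        by (auto simp: mul_def simp del: mult_eq_0_iff intro!: sum.neutral)
      then show ?thesis using a by simp
    qed (use a carrD in auto)
  qed
  then show ?thesis by (simp add: pointwise)
qed

section \<open>The notions of the theorem in terms of coefficient functions\<close>

lemma a_inv_eq_uminus:
  fixes a :: "'a \<Rightarrow> 'a \<Rightarrow> 'k::field"
  assumes "a \<in> carr"
  shows "\<ominus>\<^bsub>incidence_algebra X r\<^esub> a = - a"
proof -
  interpret A: ring "incidence_algebra X r :: ('k, 'a \<Rightarrow> 'a \<Rightarrow> 'k) module"
    by (rule incidence_algebra_ring[OF finite_X po])
  show ?thesis
    using A.minus_equality[of "- a" a] assms by (simp add: incidence_algebra_simps)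
qed

lemma linear_endo_iff:
  "linear_endo (incidence_algebra X r) \<phi> \<longleftrightarrow> \<phi> \<in> carr \<rightarrow> carr \<and>
    (\<forall>a\<in>carr. \<forall>b\<in>carr. \<phi> (a + b) = \<phi> a + \<phi> b) \<and> (\<forall>c. \<forall>a\<in>carr. \<phi> (smul c a) = smul c (\<phi> a))"
  by (simp add: linear_endo_def incidence_algebra_simps)

text \<open>The hypothesis on \<open>a\<close> and \<open>b\<close> is symmetric, so exchanging them
  also yields \<open>\<phi> b \<star> \<phi> a = delta\<close>; thus \<open>\<phi> a\<close> is a
  unit with inverse \<open>\<phi> b\<close>.\<close>

lemma inverse_preserver_iff:
  fixes \<phi> :: "('a \<Rightarrow> 'a \<Rightarrow> 'k::field) \<Rightarrow> 'a \<Rightarrow> 'a \<Rightarrow> 'k"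
  assumes \<phi>: "\<phi> \<in> carr \<rightarrow> carr"
  shows "inverse_preserver (incidence_algebra X r) \<phi> \<longleftrightarrow>
    (\<forall>a\<in>carr. \<forall>b\<in>carr. a \<star> b = delta \<and> b \<star> a = delta \<longrightarrow> \<phi> a \<star> \<phi> b = delta)"
    (is "?L \<longleftrightarrow> ?R")
proof -
  define A where "A = (incidence_algebra X r :: ('k, 'a \<Rightarrow> 'a \<Rightarrow> 'k) module)"
  interpret A: ring A
    unfolding A_def by (rule incidence_algebra_ring[OF finite_X po])
  have S: "carrier A = carr" "mult A = mul" "one A = delta"
    by (simp_all add: A_def incidence_algebra_simps)
  have unitI: "a \<in> Units A" "inv\<^bsub>A\<^esub> a = b"
    if "a \<in> carr" "b \<in> carr" "a \<star> b = delta" "b \<star> a = delta" for a b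
    using that A.inv_char[of a b] by (auto simp: Units_def S)
  show ?thesis
  proof
    assume L: ?L
    show ?R
    proof (intro ballI impI)
      fix a b :: "'a \<Rightarrow> 'a \<Rightarrow> 'k"
      assume ab: "a \<in> carr" "b \<in> carr" "a \<star> b = delta \<and> b \<star> a = delta"
      then have a: "a \<in> Units A" "inv\<^bsub>A\<^esub> a = b" using unitI by auto
      then have "\<phi> a \<in> Units A" "\<phi> b = inv\<^bsub>A\<^esub> (\<phi> a)"
        using L unfolding inverse_preserver_def A_def[symmetric] by auto
      then show "\<phi> a \<star> \<phi> b = delta"
        using A.Units_r_inv[of "\<phi> a"] by (simp add: S)
    qed
  next
    assume R: ?R
    have "\<phi> a \<in> Units A \<and> \<phi> (inv\<^bsub>A\<^esub> a) = inv\<^bsub>A\<^esub> (\<phi> a)" if a: "a \<in> Units A" for a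
    proof -
      let ?b = "inv\<^bsub>A\<^esub> a"
      have ab: "a \<in> carr" "?b \<in> carr" "a \<star> ?b = delta" "?b \<star> a = delta"
        using a A.Units_closed A.Units_inv_closed A.Units_r_inv A.Units_l_inv by (simp_all flip: S)
      have "\<phi> a \<in> carr" "\<phi> ?b \<in> carr" "\<phi> a \<star> \<phi> ?b = delta" "\<phi> ?b \<star> \<phi> a = delta"
        using R \<phi> ab by auto
      then show ?thesis using unitI[of "\<phi> a" "\<phi> ?b"] by simp
    qed
    then show ?L
      using \<phi> unfolding inverse_preserver_def A_def[symmetric] S by auto
  qed
qed

definition bijective_linear_inverse_preserver :: "(('a \<Rightarrow> 'a \<Rightarrow> 'k::field) \<Rightarrow> 'a \<Rightarrow> 'a \<Rightarrow> 'k) \<Rightarrow> bool" where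
  "bijective_linear_inverse_preserver \<phi> \<longleftrightarrow> bij_betw \<phi> carr carr \<and>
     linear_endo (incidence_algebra X r) \<phi> \<and> inverse_preserver (incidence_algebra X r) \<phi>"

text \<open>The two signs cancel in \<open>\<psi> a \<star> \<psi> b\<close>. The relation between
  the maps is symmetric, which allows passing from either one to the other.\<close>

lemma bijective_linear_inverse_preserver_uminus:
  fixes \<phi> \<psi> :: "('a \<Rightarrow> 'a \<Rightarrow> 'k::field) \<Rightarrow> 'a \<Rightarrow> 'a \<Rightarrow> 'k"
  assumes \<phi>: "bijective_linear_inverse_preserver \<phi>" and \<psi>: "\<And>a. a \<in> carr \<Longrightarrow> \<psi> a = - \<phi> a"
  shows "bijective_linear_inverse_preserver \<psi>"
proof -
  have \<phi>_carr: "\<phi> \<in> carr \<rightarrow> carr" and bij: "bij_betw \<phi> carr carr"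
    and lin: "linear_endo (incidence_algebra X r) \<phi>"
    and ip: "inverse_preserver (incidence_algebra X r) \<phi>"
    using \<phi> by (auto simp: bijective_linear_inverse_preserver_def linear_endo_iff)
  have carr: "\<psi> \<in> carr \<rightarrow> carr"
    using carr_closed(6)[OF Pi_mem[OF \<phi>_carr]] \<psi> by simp
  have "bij_betw uminus (carr :: ('a \<Rightarrow> 'a \<Rightarrow> 'k) set) carr"
    by (rule bij_betw_byWitness[of _ uminus]) auto
  then have "bij_betw (uminus \<circ> \<phi>) carr carr"
    by (rule bij_betw_trans[OF bij])
  then have "bij_betw \<psi> carr carr"
    using bij_betw_cong[of carr "uminus \<circ> \<phi>" \<psi> carr] \<psi> by simp
  moreover have "linear_endo (incidence_algebra X r) \<psi>"
    using lin carr by (simp add: linear_endo_iff \<psi> smul_simps)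
  moreover have "inverse_preserver (incidence_algebra X r) \<psi>"
    using ip unfolding inverse_preserver_iff[OF carr] inverse_preserver_iff[OF \<phi>_carr]
    by (simp add: \<psi> mul_bilinear)
  ultimately show ?thesis by (simp add: bijective_linear_inverse_preserver_def)
qed

text \<open>An automorphism carries \<open>a \<star> b = delta\<close> to the required equation, an
  anti-automorphism carries \<open>b \<star> a = delta\<close> to it.\<close>

lemma bijective_linear_inverse_preserver_if:
  fixes \<psi> :: "('a \<Rightarrow> 'a \<Rightarrow> 'k::field) \<Rightarrow> 'a \<Rightarrow> 'a \<Rightarrow> 'k"
  assumes "algebra_automorphism (incidence_algebra X r) \<psi> \<or>
    algebra_antiautomorphism (incidence_algebra X r) \<psi>"
  shows "bijective_linear_inverse_preserver \<psi>"
proof -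
  have lin: "linear_endo (incidence_algebra X r) \<psi>" and bij: "bij_betw \<psi> carr carr"
    and one: "\<psi> delta = delta"
    and mult: "(\<forall>a\<in>carr. \<forall>b\<in>carr. \<psi> (a \<star> b) = \<psi> a \<star> \<psi> b) \<or>
      (\<forall>a\<in>carr. \<forall>b\<in>carr. \<psi> (a \<star> b) = \<psi> b \<star> \<psi> a)"
    using assms by (auto simp: algebra_automorphism_def algebra_antiautomorphism_def ring_iso_def
        ring_hom_def incidence_algebra_simps)
  have carr: "\<psi> \<in> carr \<rightarrow> carr" using lin by (simp add: linear_endo_iff)
  have "\<psi> a \<star> \<psi> b = delta" if "a \<in> carr" "b \<in> carr" "a \<star> b = delta" "b \<star> a = delta" for a b
    using mult
  proof
    assume "\<forall>a\<in>carr. \<forall>b\<in>carr. \<psi> (a \<star> b) = \<psi> a \<star> \<psi> b"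
    then have "\<psi> (a \<star> b) = \<psi> a \<star> \<psi> b" using that by blast
    then show ?thesis using that one by simp
  next
    assume "\<forall>a\<in>carr. \<forall>b\<in>carr. \<psi> (a \<star> b) = \<psi> b \<star> \<psi> a"
    then have "\<psi> (b \<star> a) = \<psi> a \<star> \<psi> b" using that by blast
    then show ?thesis using that one by simp
  qed
  then show ?thesis
    using lin bij by (simp add: bijective_linear_inverse_preserver_def inverse_preserver_iff[OF carr])
qed

end

section \<open>The image of the identity\<close>

locale inverse_preserving = finite_poset X r for X :: "'a set" and r +
  fixes \<phi> :: "('a \<Rightarrow> 'a \<Rightarrow> 'k::field) \<Rightarrow> 'a \<Rightarrow> 'a \<Rightarrow> 'k"
  assumes connected: "x \<in> X \<Longrightarrow> y \<in> X \<Longrightarrow> (x, y) \<in> (r \<union> r\<inverse>)\<^sup>*"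
    and two: "(2::'k) \<noteq> 0"
    and phi_carr [simp]: "a \<in> carr \<Longrightarrow> \<phi> a \<in> carr"
    and phi_add: "a \<in> carr \<Longrightarrow> b \<in> carr \<Longrightarrow> \<phi> (a + b) = \<phi> a + \<phi> b"
    and phi_smul: "a \<in> carr \<Longrightarrow> \<phi> (smul c a) = smul c (\<phi> a)"
    and phi_inj: "inj_on \<phi> carr"
    and phi_surj: "\<phi> ` carr = carr"
    and phi_inv: "a \<in> carr \<Longrightarrow> b \<in> carr \<Longrightarrow> a \<star> b = delta \<Longrightarrow> b \<star> a = delta \<Longrightarrow> \<phi> a \<star> \<phi> b = delta"
begin

section \<open>Images of idempotents and of square-zero elements\<close>

lemma double_cancel: "a + a = b + b \<Longrightarrow> a = (b :: 'a \<Rightarrow> 'a \<Rightarrow> 'k)"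
proof (intro ext)
  fix x y assume "a + a = b + b"
  then have "2 * a x y = 2 * b x y"
    by (metis plus_fun_apply mult_2)
  then show "a x y = b x y" using two by simp
qed

lemma phi_0: "\<phi> 0 = 0"
  using phi_add[of 0 0] by simp

lemma phi_uminus: "a \<in> carr \<Longrightarrow> \<phi> (- a) = - \<phi> a"
  using phi_smul[of a "-1"] by (simp add: smul_simps)

lemma phi_diff: "a \<in> carr \<Longrightarrow> b \<in> carr \<Longrightarrow> \<phi> (a - b) = \<phi> a - \<phi> b"
  using phi_add[of a "- b"] by (simp add: phi_uminus)

lemma phi_eq_0_iff: "a \<in> carr \<Longrightarrow> \<phi> a = 0 \<longleftrightarrow> a = 0"
  using inj_on_eq_iff[OF phi_inj, of a 0] phi_0 by simp

abbreviation v :: "'a \<Rightarrow> 'a \<Rightarrow> 'k" where "v \<equiv> \<phi> delta"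

lemma v_square: "v \<star> v = delta"
  by (rule phi_inv) auto

text \<open>Since \<open>delta - e - e\<close> is its own inverse, \<open>v - 2w\<close> with
  \<open>w = \<phi> e\<close> squares to \<open>delta = v \<star> v\<close>. Expanding gives twice
  the claim.\<close>

lemma phi_idempotent:
  assumes e: "e \<in> carr" "e \<star> e = e"
  shows "\<phi> e \<star> \<phi> e + \<phi> e \<star> \<phi> e = v \<star> \<phi> e + \<phi> e \<star> v"
proof -
  let ?u = "delta - e - e" and ?w = "\<phi> e"
  have "?u \<star> ?u = delta"
    unfolding mul_bilinear using e by simp
  then have "\<phi> ?u \<star> \<phi> ?u = delta"
    using e(1) by (intro phi_inv carr_closed)
  moreover have "\<phi> ?u = v - ?w - ?w"
    using e(1) by (simp only: phi_diff carr_closed)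
  ultimately have "(v - ?w - ?w) \<star> (v - ?w - ?w) = v \<star> v"
    by (simp only: v_square)
  then have "(?w \<star> ?w + ?w \<star> ?w) + (?w \<star> ?w + ?w \<star> ?w) = (v \<star> ?w + ?w \<star> v) + (v \<star> ?w + ?w \<star> v)"
    unfolding mul_bilinear by (simp only: algebra_simps)
      (simp only: add.assoc[symmetric] add_right_cancel)
  then show ?thesis by (rule double_cancel)
qed

text \<open>With \<open>w = \<phi> n\<close>, multiplying the images of \<open>delta + n\<close> and
  \<open>delta - n\<close> in both orders gives \<open>vw + ww = wv\<close> and
  \<open>wv + ww = vw\<close>; together they force \<open>2ww = 0\<close>.\<close>

lemma phi_square_zero:
  assumes n: "n \<in> carr" "n \<star> n = 0"
  shows "\<phi> n \<star> \<phi> n = 0" "v \<star> \<phi> n = \<phi> n \<star> v"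
proof -
  let ?w = "\<phi> n"
  have *: "(delta + n) \<star> (delta - n) = delta" "(delta - n) \<star> (delta + n) = delta"
    using n by (simp_all add: mul_bilinear)
  have "\<phi> (delta + n) \<star> \<phi> (delta - n) = v \<star> v" "\<phi> (delta - n) \<star> \<phi> (delta + n) = v \<star> v"
    using n * by (simp_all add: phi_inv v_square)
  then have **: "v \<star> ?w + ?w \<star> ?w = ?w \<star> v" "?w \<star> v + ?w \<star> ?w = v \<star> ?w"
    using n by (simp_all add: phi_add phi_diff mul_bilinear algebra_simps)
  have "?w \<star> ?w + ?w \<star> ?w = 0 + 0"
    using **(2)
    unfolding **(1)[symmetric] by (simp add: algebra_simps)
  then show "?w \<star> ?w = 0" by (rule double_cancel)
  with ** show "v \<star> ?w = ?w \<star> v" by simp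
qed

section \<open>Diagonal entries of images\<close>

lemma v_diag: "x \<in> X \<Longrightarrow> v x x * v x x = 1"
  using mul_diag[of x v v] by (simp add: v_square) (simp add: delta_def)

lemma v_diag_neq_0: "x \<in> X \<Longrightarrow> v x x \<noteq> 0"
  using v_diag[of x] by auto

text \<open>Diagonal entries multiply, so at \<open>z\<close> the identity for idempotents becomes
  \<open>2 t (t - v z z) = 0\<close> for \<open>t = \<phi> e z z\<close>.\<close>

lemma phi_idempotent_diag:
  assumes e: "e \<in> carr" "e \<star> e = e" and z: "z \<in> X"
  shows "\<phi> e z z = 0 \<or> \<phi> e z z = v z z"
proof -
  have "(\<phi> e \<star> \<phi> e + \<phi> e \<star> \<phi> e) z z = (v \<star> \<phi> e + \<phi> e \<star> v) z z"
    using phi_idempotent[OF e] by simp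
  then have "2 * (\<phi> e z z * (\<phi> e z z - v z z)) = 0"
    using z by (simp add: pointwise mul_diag algebra_simps)
  then show ?thesis using two by auto
qed

text \<open>Otherwise both entries equal \<open>v z z\<close>, and the idempotent
  \<open>E x x + E y y\<close> has the image entry \<open>2 * v z z\<close>, which is neither 0 nor
  \<open>v z z\<close>.\<close>

lemma phi_E_diag_unique:
  assumes x: "x \<in> X" "y \<in> X" "x \<noteq> y" and z: "z \<in> X"
  shows "\<phi> (E x x) z z = 0 \<or> \<phi> (E y y) z z = 0"
proof -
  have "(E x x + E y y) \<star> (E x x + E y y) = E x x + E y y"
    using x by (simp add: mul_bilinear mul_E_E r_refl)
  then have "\<phi> (E x x) z z + \<phi> (E y y) z z = 0 \<or> \<phi> (E x x) z z + \<phi> (E y y) z z = v z z"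
    using phi_idempotent_diag[of "E x x + E y y" z] x z by (simp add: phi_add r_refl plus_fun_apply)
  moreover have "\<phi> (E x x) z z = 0 \<or> \<phi> (E x x) z z = v z z" "\<phi> (E y y) z z = 0 \<or> \<phi> (E y y) z z = v z z"
    using x z by (simp_all add: phi_idempotent_diag mul_E_E r_refl)
  ultimately show ?thesis
    using v_diag_neq_0[OF z] two by (metis add_cancel_right_right mult_2 mult_eq_0_iff)
qed

lemma phi_E_strict_diag:
  assumes "(x, y) \<in> r" "x \<noteq> y" "z \<in> X"
  shows "\<phi> (E x y) z z = 0"
proof -
  have "(\<phi> (E x y) \<star> \<phi> (E x y)) z z = 0"
    using assms by (simp add: phi_square_zero mul_E_E zero_fun_apply)
  then show ?thesis using assms by (simp add: mul_diag)
qed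

text \<open>For each \<open>z\<close>, the vertex \<open>f z\<close> is the only \<open>x\<close>
  for which \<open>\<phi> (E x x)\<close> has a nonzero entry at \<open>z\<close>. It exists because
  otherwise all images would vanish at \<open>z\<close>, contrary to
  \<open>v z z \<noteq> 0\<close>.\<close>

lemma phi_diag:
  obtains f where "bij_betw f X X"
    "\<And>a z. a \<in> carr \<Longrightarrow> z \<in> X \<Longrightarrow> \<phi> a z z = a (f z) (f z) * v z z"
proof -
  have *: "\<exists>x\<in>X. \<phi> (E x x) z z \<noteq> 0" if z: "z \<in> X" for z
  proof (rule ccontr)
    assume none: "\<not> ?thesis"
    have "\<phi> a z z = 0" if "a \<in> carr" for a
      using that
    proof (induction a rule: carr_induct)
      case (E c x y)
      have "\<phi> (E x y) z z = 0"
        using none phi_E_strict_diag[OF E _ z] r_X[OF E] by (cases "x = y") auto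
      then show ?case using E by (simp add: phi_smul) (simp add: smul_def)
    next
      case zero
      show ?case unfolding phi_0 by (simp add: zero_fun_apply)
    next
      case (add a b)
      then show ?case unfolding phi_add[OF add(1,2)] by (simp add: plus_fun_apply)
    qed
    then show False using v_diag_neq_0[OF z] by simp
  qed
  then have "\<forall>z\<in>X. \<exists>x. x \<in> X \<and> \<phi> (E x x) z z \<noteq> 0"
    by blast
  then obtain f where "\<forall>z\<in>X. f z \<in> X \<and> \<phi> (E (f z) (f z)) z z \<noteq> 0"
    by (auto dest: bchoice)
  then have f: "\<And>z. z \<in> X \<Longrightarrow> f z \<in> X" "\<And>z. z \<in> X \<Longrightarrow> \<phi> (E (f z) (f z)) z z \<noteq> 0"
    by auto
  have E_diag: "\<phi> (E x x) z z = (if x = f z then v z z else 0)" if "x \<in> X" "z \<in> X" for x z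
    using that f phi_E_diag_unique[of x "f z" z] phi_idempotent_diag[of "E (f z) (f z)" z]
    by (auto simp: mul_E_E r_refl)
  have diag: "\<phi> a z z = a (f z) (f z) * v z z" if "a \<in> carr" "z \<in> X" for a z
    using that
  proof (induction a rule: carr_induct)
    case (E c x y)
    have "\<phi> (E x y) z z = E x y (f z) (f z) * v z z"
    proof (cases "x = y")
      case True
      then have "E x y (f z) (f z) = (if x = f z then 1 else 0 :: 'k)" by (simp add: E_def)
      then show ?thesis using True E E_diag[of x z] r_X[of x y] by (auto split: if_splits)
    next
      case False
      then have "E x y (f z) (f z) = (0 :: 'k)" by (auto simp: E_def)
      then show ?thesis using E False phi_E_strict_diag[of x y z] by simp
    qed
    then show ?case using E by (simp add: phi_smul) (simp add: smul_def)
  next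
    case zero
    show ?case unfolding phi_0 by (simp add: zero_fun_apply)
  next
    case (add a b)
    then show ?case unfolding phi_add[OF add(1,2)] by (simp add: plus_fun_apply algebra_simps)
  qed
  have "inj_on f X"
  proof (rule inj_onI, rule ccontr)
    fix x y assume x: "x \<in> X" "y \<in> X" "f x = f y" "x \<noteq> y"
    \<comment> \<open>A preimage of \<open>E x x\<close> would have to be both nonzero and zero at
      the common vertex \<open>f x = f y\<close>.\<close>
    have "E x x \<in> \<phi> ` carr"
      using x(1) by (simp add: phi_surj r_refl)
    then obtain a where a: "a \<in> carr" "\<phi> a = E x x" by force
    have "a (f x) (f x) * v x x = 1" "a (f y) (f y) * v y y = 0"
      using diag[of a x] diag[of a y] a x by (simp_all add: E_def[of x x])
    then show False using x v_diag_neq_0[of y] by simp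
  qed
  then have "bij_betw f X X"
    using endo_inj_surj[OF finite_X] f(1) by (auto simp: bij_betw_def)
  then show thesis using that diag by blast
qed

text \<open>The strictly upper triangular elements form the Jacobson radical, which \<open>\<phi>\<close> maps onto itself.\<close>

definition radical :: "('a \<Rightarrow> 'a \<Rightarrow> 'k) set" where
  "radical = {a \<in> carr. \<forall>x. a x x = 0}"

lemma v_commutes_phi_radical:
  assumes "a \<in> radical"
  shows "v \<star> \<phi> a = \<phi> a \<star> v"
proof -
  \<comment> \<open>Induction over \<open>carr\<close> needs a claim about all of
    \<open>carr\<close>: \<open>off\<close> is linear, deletes the diagonal and fixes the
    radical.\<close>
  define off where "off a = (\<lambda>x y. if x = y then 0 else a x y)" for a :: "'a \<Rightarrow> 'a \<Rightarrow> 'k"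
  have off: "off a \<in> carr" if "a \<in> carr" for a
    using that by (auto simp: carr_def off_def)
  have "v \<star> \<phi> (off a) = \<phi> (off a) \<star> v" if "a \<in> carr" for a
    using that
  proof (induction a rule: carr_induct)
    case zero
    have "off 0 = 0" by (auto simp: off_def pointwise)
    then show ?case by (simp only: phi_0 mul_bilinear)
  next
    case (add a b)
    have "off (a + b) = off a + off b" by (auto simp: off_def pointwise)
    then show ?case using add off[of a] off[of b] by (simp only: phi_add mul_bilinear)
  next
    case (E c x y)
    show ?case
    proof (cases "x = y")
      case True
      then have "off (smul c (E x y)) = 0" by (auto simp: off_def pointwise smul_def E_def)
      then show ?thesis by (simp only: phi_0 mul_bilinear)
    next
      case False
      then have "off (smul c (E x y)) = smul c (E x y)" by (auto simp: off_def pointwise smul_def E_def)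
      moreover have "v \<star> \<phi> (E x y) = \<phi> (E x y) \<star> v"
        using E False by (simp add: phi_square_zero mul_E_E)
      ultimately show ?thesis
        using E by (simp add: phi_smul mul_bilinear)
    qed
  qed
  moreover have "off a = a" "a \<in> carr"
    using assms by (auto simp: radical_def off_def pointwise)
  ultimately show ?thesis by force
qed

text \<open>The preimage of \<open>b\<close> lies in the radical too: \<open>f\<close> reaches every
  vertex and \<open>v z z \<noteq> 0\<close>, so a zero diagonal of \<open>\<phi> a\<close> forces
  one of \<open>a\<close>.\<close>

lemma v_commutes_radical:
  assumes "b \<in> radical"
  shows "v \<star> b = b \<star> v"
proof -
  obtain f where f: "bij_betw f X X"
    "\<And>a z. a \<in> carr \<Longrightarrow> z \<in> X \<Longrightarrow> \<phi> a z z = a (f z) (f z) * v z z"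
    using phi_diag by blast
  obtain a where a: "a \<in> carr" "b = \<phi> a"
    using assms phi_surj unfolding radical_def by blast
  have "a x x = 0" for x
  proof (cases "x \<in> X")
    case True
    then obtain z where z: "z \<in> X" "x = f z"
      using f(1) by (auto simp: bij_betw_def)
    have "\<phi> a z z = 0" using assms a by (simp add: radical_def)
    then show ?thesis using f(2)[OF a(1) z(1)] v_diag_neq_0[OF z(1)] z by simp
  next
    case False
    then show ?thesis using carrD[OF a(1), of x x] r_X(1)[of x x] by blast
  qed
  then show ?thesis
    using v_commutes_phi_radical[of a] a by (simp add: radical_def)
qed

section \<open>The image of the identity is plus or minus the identity\<close>

text \<open>For \<open>x < y\<close> the radical contains \<open>E x y\<close>; comparing entries at
  \<open>(x, y)\<close> in \<open>v \<star> E x y = E x y \<star> v\<close> gives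
  \<open>v x x = v y y\<close>. Connectedness spreads this over \<open>X\<close>.\<close>

lemma v_diag_const: "x \<in> X \<Longrightarrow> y \<in> X \<Longrightarrow> v x x = v y y"
proof -
  have step: "v x x = v y y" if xy: "(x, y) \<in> r" for x y
  proof (cases "x = y")
    case False
    then have "v \<star> E x y = E x y \<star> v"
      using xy by (intro v_commutes_radical) (auto simp: radical_def E_def carr_def)
    then have "(v \<star> E x y) x y = (E x y \<star> v) x y" by simp
    then show ?thesis using xy by (simp add: mul_E_left mul_E_right)
  qed simp
  assume "x \<in> X" "y \<in> X"
  then have "(x, y) \<in> (r \<union> r\<inverse>)\<^sup>*" by (rule connected)
  then show ?thesis
    by (induction rule: rtrancl_induct) (auto simp: step)
qed

lemma v_cases: "v = delta \<or> v = - delta"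
proof -
  \<comment> \<open>The common diagonal entry of \<open>v\<close>, or 1 if \<open>X\<close> is
    empty.\<close>
  obtain c where c: "c * c = 1" "\<And>x. x \<in> X \<Longrightarrow> v x x = c"
  proof (cases "X = {}")
    case False
    then obtain x where x: "x \<in> X" by auto
    show thesis
      using that[of "v x x"] v_diag[OF x] v_diag_const[OF _ x] by blast
  qed (use that[of 1] in auto)
  define m where "m = v - smul c delta"
  have m: "m \<in> carr" "v = smul c delta + m" by (simp_all add: m_def)
  have "c \<noteq> 0" using c by auto
  have "v \<star> v = smul (c * c) delta + (smul c m + (smul c m + m \<star> m))"
    unfolding m(2) using m(1) by (simp only: mul_bilinear delta_mul carr_closed smul_simps add.assoc)
  then have mm: "smul c m + (smul c m + m \<star> m) = 0"
    unfolding v_square c(1) smul_simps(5) by (simp only: add_cancel_right_right)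
  \<comment> \<open>From \<open>m \<star> m = - 2 c m\<close>, this factor makes
    \<open>smul k m\<close> idempotent; its diagonal is zero, so it vanishes.\<close>
  define k where "k = - 1 / (2 * c)"
  have k: "2 * c * k = - 1"
    using two \<open>c \<noteq> 0\<close> by (simp add: k_def)
  have "smul k m \<star> smul k m = smul k m"
  proof (intro ext)
    fix x y
    have "c * m x y + (c * m x y + (m \<star> m) x y) = 0"
      using fun_cong[OF fun_cong[OF mm], of x y] by (simp only: plus_fun_apply zero_fun_apply smul_def)
    moreover have "2 * c * m x y = c * m x y + c * m x y"
      unfolding mult.assoc by (rule mult_2)
    ultimately have "(m \<star> m) x y = - (2 * c * m x y)"
      unfolding eq_neg_iff_add_eq_0 by (simp only: add_ac)
    then have "k * (m \<star> m) x y = - (2 * c * k) * m x y"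
      by (simp only: mult_ac mult_minus_left mult_minus_right)
    then show "(smul k m \<star> smul k m) x y = smul k m x y"
      unfolding mul_bilinear unfolding k by (simp add: smul_def)
  qed
  then have "smul k m = 0"
  proof (intro idempotent_zero_diag)
    fix x assume "x \<in> X"
    then have "m x x = 0" using c(2) by (simp add: m_def smul_def) (simp add: delta_def)
    then show "smul k m x x = 0" by (simp add: smul_def)
  qed (simp_all add: m(1))
  then have "m = 0"
    using k by (auto simp: smul_eq_0_iff)
  then have "v = smul c delta" using m by simp
  moreover have "c = 1 \<or> c = - 1"
    using c(1) by (simp add: square_eq_1_iff)
  ultimately show ?thesis by (auto simp: smul_simps)
qed

end

section \<open>Unital inverse preservers\<close>

locale unital_inverse_preserving = inverse_preserving X r \<phi>
  for X :: "'a set" and r and \<phi> :: "('a \<Rightarrow> 'a \<Rightarrow> 'k::field) \<Rightarrow> 'a \<Rightarrow> 'a \<Rightarrow> 'k" +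
  assumes unital: "\<phi> delta = delta"
begin

section \<open>The idempotents \<open>g x\<close> and their Peirce decomposition\<close>

abbreviation g :: "'a \<Rightarrow> 'a \<Rightarrow> 'a \<Rightarrow> 'k" where "g x \<equiv> \<phi> (E x x)"

abbreviation n :: "'a \<Rightarrow> 'a \<Rightarrow> 'a \<Rightarrow> 'a \<Rightarrow> 'k" where "n x y \<equiv> \<phi> (E x y)"

lemma phi_idem:
  assumes e: "e \<in> carr" "e \<star> e = e"
  shows "\<phi> e \<star> \<phi> e = \<phi> e"
proof (rule double_cancel)
  show "\<phi> e \<star> \<phi> e + \<phi> e \<star> \<phi> e = \<phi> e + \<phi> e"
    using phi_idempotent[OF e] unfolding unital delta_mul[OF phi_carr[OF e(1)]] .
qed

text \<open>Multiplying \<open>ba = - ab\<close> by \<open>a\<close> on the left and on the right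
  gives \<open>aba = - ab\<close> and \<open>ba = - aba\<close>. Hence \<open>ba = ab\<close>, and
  \<open>2ab = 0\<close>.\<close>

lemma anticommuting_idempotent:
  assumes g: "a \<star> a = a" and ab: "a \<star> b + b \<star> a = (0 :: 'a \<Rightarrow> 'a \<Rightarrow> 'k)"
  shows "a \<star> b = 0"
proof -
  have ba: "b \<star> a = - (a \<star> b)"
    using ab unfolding add_eq_0_iff .
  have "a \<star> b \<star> a = - (a \<star> a \<star> b)"
    by (simp only: mul_assoc ba mul_bilinear)
  moreover have "b \<star> a = - (a \<star> b \<star> a)"
    using arg_cong[OF ba, of "\<lambda>c. c \<star> a"] by (simp only: mul_assoc g mul_bilinear)
  ultimately have "a \<star> b + a \<star> b = 0 + 0"
    using ab by (simp add: g)
  then show ?thesis by (rule double_cancel)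
qed

lemma g_carr [simp]: "x \<in> X \<Longrightarrow> g x \<in> carr"
  by (simp add: r_refl)

text \<open>For \<open>x \<noteq> y\<close> the image of the idempotent \<open>E x x + E y y\<close>
  is idempotent, so \<open>g x\<close> and \<open>g y\<close> anticommute.\<close>

lemma g_mul: "x \<in> X \<Longrightarrow> y \<in> X \<Longrightarrow> g x \<star> g y = (if x = y then g x else 0)"
proof -
  assume x: "x \<in> X" "y \<in> X"
  have id: "g z \<star> g z = g z" if "z \<in> X" for z
    using that by (simp add: phi_idem r_refl mul_E_E)
  show ?thesis
  proof (cases "x = y")
    case False
    have "\<phi> (E x x + E y y) \<star> \<phi> (E x x + E y y) = \<phi> (E x x + E y y)"
      using x False by (intro phi_idem) (simp_all add: mul_bilinear mul_E_E r_refl)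
    then have "g x \<star> g y + g y \<star> g x = 0"
      using x False by (simp add: phi_add r_refl mul_bilinear id algebra_simps)
    then show ?thesis
      using anticommuting_idempotent[OF id[OF x(1)]] False by simp
  qed (simp add: id x)
qed

lemma g_mul_mul: "x \<in> X \<Longrightarrow> y \<in> X \<Longrightarrow> g x \<star> (g y \<star> a) = (if x = y then g x \<star> a else 0)"
  by (simp add: g_mul mul_bilinear flip: mul_assoc)

definition strict :: "'a \<Rightarrow> 'a \<Rightarrow> bool" where
  "strict x y \<longleftrightarrow> (x, y) \<in> r \<and> x \<noteq> y"

lemma strict_X: "strict x y \<Longrightarrow> x \<in> X \<and> y \<in> X"
  by (auto simp: strict_def r_X)

lemma n_square: "strict x y \<Longrightarrow> n x y \<star> n x y = 0"
  by (rule phi_square_zero) (auto simp: strict_def mul_E_E)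

lemma n_neq_0: "strict x y \<Longrightarrow> n x y \<noteq> 0"
proof -
  assume xy: "strict x y"
  have "E x y \<noteq> (0 :: 'a \<Rightarrow> 'a \<Rightarrow> 'k)"
    by (auto simp: pointwise E_def intro!: exI[of _ x] exI[of _ y])
  then show ?thesis using xy by (simp add: phi_eq_0_iff strict_def)
qed

text \<open>\<open>E z z + E x y\<close> is idempotent when \<open>z\<close> is an endpoint of the
  edge; expand the square of its image, using that \<open>n x y\<close> squares to zero.\<close>

lemma g_n_jordan:
  assumes xy: "strict x y" and z: "z = x \<or> z = y"
  shows "g z \<star> n x y + n x y \<star> g z = n x y"
proof -
  have zX: "z \<in> X" using xy z strict_X by auto
  have "\<phi> (E z z + E x y) \<star> \<phi> (E z z + E x y) = \<phi> (E z z + E x y)"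
    using xy z zX by (intro phi_idem) (auto simp: strict_def mul_bilinear mul_E_E r_refl)
  then show ?thesis
    using xy zX n_square[OF xy] by (simp add: strict_def phi_add r_refl mul_bilinear g_mul algebra_simps)
qed

text \<open>Insert the Jordan relation for \<open>y\<close> into the one for \<open>x\<close>;
  orthogonality of \<open>g x\<close> and \<open>g y\<close> removes the other terms.\<close>

lemma n_peirce:
  assumes xy: "strict x y"
  shows "n x y = g x \<star> n x y \<star> g y + g y \<star> n x y \<star> g x"
proof -
  have x: "x \<in> X" "y \<in> X" "x \<noteq> y"
    using xy strict_X by (auto simp: strict_def)
  have "g x \<star> n x y = g x \<star> (g y \<star> n x y + n x y \<star> g y)"
    using g_n_jordan[OF xy, of y] by simp
  moreover have "n x y \<star> g x = (g y \<star> n x y + n x y \<star> g y) \<star> g x"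
    using g_n_jordan[OF xy, of y] by simp
  ultimately have "g x \<star> n x y + n x y \<star> g x = g x \<star> n x y \<star> g y + g y \<star> n x y \<star> g x"
    using x by (simp add: mul_bilinear mul_assoc g_mul g_mul_mul)
  then show ?thesis
    using g_n_jordan[OF xy, of x] by simp
qed

text \<open>By the Peirce decomposition the image of \<open>E u w\<close> lies in the corners
  \<open>(u, w)\<close> and \<open>(w, u)\<close>, so only the coefficient at \<open>(x, y)\<close>
  is visible here.\<close>

lemma g_phi_g:
  assumes b: "b \<in> carr" and xy: "strict x y"
  shows "g x \<star> \<phi> b \<star> g y = smul (b x y) (g x \<star> n x y \<star> g y)"
    "g y \<star> \<phi> b \<star> g x = smul (b x y) (g y \<star> n x y \<star> g x)"
proof -
  have x: "x \<in> X" "y \<in> X" "x \<noteq> y" "(y, x) \<notin> r"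
    using xy strict_X r_antisym by (auto simp: strict_def)
  have "g x \<star> \<phi> b \<star> g y = smul (b x y) (g x \<star> n x y \<star> g y) \<and>
    g y \<star> \<phi> b \<star> g x = smul (b x y) (g y \<star> n x y \<star> g x)"
    using b
  proof (induction b rule: carr_induct)
    case zero
    show ?case unfolding phi_0 mul_bilinear by (simp add: zero_fun_apply smul_simps)
  next
    case (add a b)
    then show ?case unfolding phi_add[OF add(1,2)] mul_bilinear by (simp add: plus_fun_apply smul_simps)
  next
    case (E c u w)
    have "g x \<star> n u w \<star> g y = (if x = u \<and> y = w then g x \<star> n x y \<star> g y else 0) \<and>
       g y \<star> n u w \<star> g x = (if x = u \<and> y = w then g y \<star> n x y \<star> g x else 0)"
    proof (cases "strict u w")
      case True
      \<comment> \<open>The reversed edge would meet the same corners; antisymmetry excludes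
        it.\<close>
      have "(u, w) \<noteq> (y, x)" using E x by auto
      show ?thesis
      proof (cases "x = u \<and> y = w")
        case False
        with \<open>(u, w) \<noteq> (y, x)\<close> show ?thesis
          using x strict_X[OF True] by (subst (1 2) n_peirce[OF True])
            (auto simp: mul_bilinear mul_assoc g_mul g_mul_mul)
      qed simp
    next
      case False
      then have "u = w" using E by (auto simp: strict_def)
      then show ?thesis
        using x r_X[OF E] by (auto simp: mul_bilinear mul_assoc g_mul g_mul_mul)
    qed
    moreover have "smul c (E u w) x y = (if x = u \<and> y = w then c else 0)"
      by (simp add: smul_def E_def)
    ultimately show ?case
      using E by (simp add: phi_smul mul_bilinear smul_simps)
  qed
  then show "g x \<star> \<phi> b \<star> g y = smul (b x y) (g x \<star> n x y \<star> g y)"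
    "g y \<star> \<phi> b \<star> g x = smul (b x y) (g y \<star> n x y \<star> g x)"
    by simp_all
qed

text \<open>As \<open>\<phi>\<close> is onto, this says that the corner of \<open>g x\<close>
  consists of scalar multiples of \<open>g x\<close>.\<close>

lemma g_phi_g_same:
  assumes b: "b \<in> carr" and x: "x \<in> X"
  shows "g x \<star> \<phi> b \<star> g x = smul (b x x) (g x)"
  using b
proof (induction b rule: carr_induct)
  case zero
  show ?case unfolding phi_0 mul_bilinear by (simp add: zero_fun_apply smul_simps)
next
  case (add a b)
  then show ?case unfolding phi_add[OF add(1,2)] mul_bilinear by (simp add: plus_fun_apply smul_simps)
next
  case (E c u w)
  have "g x \<star> n u w \<star> g x = (if x = u \<and> x = w then g x else 0)"
  proof (cases "strict u w")
    case True
    then show ?thesis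
      using x strict_X[OF True] by (subst n_peirce[OF True])
        (auto simp: mul_bilinear mul_assoc g_mul g_mul_mul strict_def)
  next
    case False
    then have "u = w" using E by (auto simp: strict_def)
    then show ?thesis
      using x r_X[OF E] by (auto simp: mul_bilinear mul_assoc g_mul g_mul_mul)
  qed
  moreover have "smul c (E u w) x x = (if x = u \<and> x = w then c else 0)"
    by (auto simp add: smul_def E_def)
  ultimately show ?case
    using E by (auto simp add: phi_smul mul_bilinear smul_simps)
qed

section \<open>Orientation of the edges\<close>

text \<open>The edge keeps its direction, as under an automorphism; \<open>down\<close> is the
  reversal found under an anti-automorphism.\<close>

definition up :: "'a \<Rightarrow> 'a \<Rightarrow> bool" where
  "up x y \<longleftrightarrow> g x \<star> n x y \<star> g y = n x y"

definition down :: "'a \<Rightarrow> 'a \<Rightarrow> bool" where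
  "down x y \<longleftrightarrow> g y \<star> n x y \<star> g x = n x y"

text \<open>Write the first Peirce summand as \<open>?P = \<phi> a\<close>. Compressing to both
  corners brings in the same scalar \<open>a x y\<close>: \<open>?P = a x y * ?P\<close> and
  \<open>0 = a x y * ?Q\<close>, so one summand is 0.\<close>

lemma up_or_down:
  assumes xy: "strict x y"
  shows "up x y \<or> down x y"
proof -
  let ?P = "g x \<star> n x y \<star> g y" and ?Q = "g y \<star> n x y \<star> g x"
  have x: "x \<in> X" "y \<in> X" "x \<noteq> y"
    using xy strict_X by (auto simp: strict_def)
  have "?P \<in> \<phi> ` carr" by (simp add: phi_surj)
  then obtain a where a: "a \<in> carr" "\<phi> a = ?P" by force
  have "g x \<star> ?P \<star> g y = smul (a x y) ?P" "g y \<star> ?P \<star> g x = smul (a x y) ?Q"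
    using g_phi_g[OF a(1) xy] a(2) by simp_all
  moreover have "g x \<star> ?P \<star> g y = ?P" "g y \<star> ?P \<star> g x = 0"
    using x by (simp_all add: mul_assoc g_mul g_mul_mul mul_bilinear)
  ultimately have "?P = 0 \<or> ?Q = 0"
    by (auto simp: smul_eq_0_iff smul_simps)
  then show ?thesis
    using n_peirce[OF xy] unfolding up_def down_def by auto
qed

text \<open>
  A diagonal entry \<open>g x s s \<noteq> 0\<close> makes \<open>g x\<close> a multiple of \<open>g x \<star> E s s \<star> g x\<close>, which reduces the claim to
  products \<open>p \<star> E s s \<star> q\<close>; their entries are \<open>p t s * q s u\<close>.
\<close>

lemma nondegenerate:
  assumes x: "x \<in> X" and a: "a \<in> carr" "a \<star> g x \<noteq> 0" and b: "b \<in> carr" "g x \<star> b \<noteq> 0"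
  shows "a \<star> g x \<star> b \<noteq> 0"
proof
  assume agb: "a \<star> g x \<star> b = 0"
  have "g x \<noteq> 0" using a by (auto simp: mul_bilinear)
  \<comment> \<open>A nonzero idempotent has a nonzero diagonal entry.\<close>
  then obtain s where s: "s \<in> X" "g x s s \<noteq> 0"
    using idempotent_zero_diag[of "g x"] x g_mul[of x x] by auto
  have "E s s \<in> \<phi> ` carr" using s by (simp add: phi_surj r_refl)
  then obtain e where e: "e \<in> carr" "\<phi> e = E s s" by force
  define c where "c = e x x"
  have gEg: "g x \<star> E s s \<star> g x = smul c (g x)"
    using g_phi_g_same[OF e(1) x] e(2) by (simp add: c_def)
  have "g x s s * g x s s = c * g x s s"
    using fun_cong[OF fun_cong[OF gEg], of s s] x s mul_E_mul[of "g x" "g x" s s s]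
    by (simp add: smul_def)
  then have c: "c \<noteq> 0" using s by simp
  define p where "p = a \<star> g x \<star> E s s"
  define q where "q = E s s \<star> (g x \<star> b)"
  have carr: "p \<in> carr" "q \<in> carr" by (simp_all add: p_def q_def)
  have "p \<star> g x = a \<star> (g x \<star> E s s \<star> g x)" by (simp only: p_def mul_assoc)
  also have "\<dots> = smul c (a \<star> g x)" by (simp only: gEg mul_bilinear)
  finally have "p \<noteq> 0"
    using c a by (auto simp: mul_bilinear smul_eq_0_iff dest!: sym[of 0])
  have "g x \<star> q = (g x \<star> E s s \<star> g x) \<star> b" by (simp only: q_def mul_assoc)
  also have "\<dots> = smul c (g x \<star> b)" by (simp only: gEg mul_bilinear)
  finally have "q \<noteq> 0"
    using c b by (auto simp: mul_bilinear smul_eq_0_iff dest!: sym[of 0])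
  obtain t w where tw: "p t w \<noteq> 0"
    using \<open>p \<noteq> 0\<close> by (auto simp: pointwise)
  then have t: "p t s \<noteq> 0"
    using mul_E_right[of "a \<star> g x" s s t w] s by (auto simp: p_def r_refl split: if_splits)
  obtain z u where zu: "q z u \<noteq> 0"
    using \<open>q \<noteq> 0\<close> by (auto simp: pointwise)
  then have u: "q s u \<noteq> 0"
    using mul_E_left[of "g x \<star> b" s s z u] s by (auto simp: q_def r_refl split: if_splits)
  have "p \<star> E s s \<star> q = a \<star> g x \<star> (E s s \<star> E s s \<star> E s s) \<star> g x \<star> b"
    by (simp only: p_def q_def mul_assoc)
  also have "\<dots> = a \<star> (g x \<star> E s s \<star> g x) \<star> b"
    using s by (simp add: mul_E_E r_refl mul_assoc)
  also have "\<dots> = smul c (a \<star> g x \<star> b)"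
    by (simp only: gEg mul_bilinear)
  also have "\<dots> = 0" by (simp add: agb smul_simps)
  finally have "p t s * q s u = 0"
    using mul_E_mul[OF carr s(1), of t u] by (simp add: zero_fun_apply)
  then show False using t u by simp
qed

section \<open>Adjacent edges have the same orientation\<close>

text \<open>The edges compose in neither order, so \<open>E x y + E u w\<close> squares to zero, and
  so does its image.\<close>

lemma n_jordan_zero:
  assumes "strict x y" "strict u w" "y \<noteq> u" "x \<noteq> w"
  shows "n x y \<star> n u w + n u w \<star> n x y = 0"
proof -
  have "\<phi> (E x y + E u w) \<star> \<phi> (E x y + E u w) = 0"
    using assms by (intro phi_square_zero) (auto simp: strict_def mul_bilinear mul_E_E)
  then show ?thesis
    using assms n_square[of x y] n_square[of u w]
    by (simp add: strict_def phi_add mul_bilinear algebra_simps)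
qed

lemma n_jordan_chain:
  assumes xy: "strict x y" and yz: "strict y z"
  shows "strict x z" "n x y \<star> n y z + n y z \<star> n x y = n x z"
proof -
  show xz: "strict x z"
    using assms r_trans r_antisym by (auto simp: strict_def)
  have X: "x \<in> X" "y \<in> X" "z \<in> X" and ne: "x \<noteq> y" "y \<noteq> z" "x \<noteq> z"
    using assms xz strict_X by (auto simp: strict_def)
  let ?C = "carr :: ('a \<Rightarrow> 'a \<Rightarrow> 'k) set"
  have E: "E x y \<in> ?C" "E y z \<in> ?C" "E x z \<in> ?C" "E y y \<in> ?C"
    using assms xz X by (auto simp: strict_def r_refl)
  \<comment> \<open>This is \<open>(E x y + E y y) \<star> (E y y + E y z)\<close>, an idempotent
    containing both edges and their composite.\<close>
  let ?e = "E y y + E x y + E y z + E x z :: 'a \<Rightarrow> 'a \<Rightarrow> 'k"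
  have "?e \<star> ?e = ?e"
    using xy yz xz ne X by (simp add: strict_def mul_bilinear mul_E_E r_refl algebra_simps)
  then have "\<phi> ?e \<star> \<phi> ?e = \<phi> ?e"
    using E by (intro phi_idem) auto
  then have *: "(g y + n x y + n y z + n x z) \<star> (g y + n x y + n y z + n x z) = g y + n x y + n y z + n x z"
    using E by (simp add: phi_add)
  have "g y \<star> n x z = 0" "n x z \<star> g y = 0"
    using X ne by (subst n_peirce[OF xz], simp add: mul_bilinear mul_assoc g_mul g_mul_mul)+
  moreover have "g y \<star> n x y + n x y \<star> g y = n x y" "g y \<star> n y z + n y z \<star> g y = n y z"
    using g_n_jordan[OF xy, of y] g_n_jordan[OF yz, of y] by simp_all
  moreover have "n x y \<star> n x z + n x z \<star> n x y = 0" "n y z \<star> n x z + n x z \<star> n y z = 0"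
    using n_jordan_zero[OF xy xz] n_jordan_zero[OF yz xz] ne by simp_all
  moreover have "(g y + n x y + n y z + n x z) \<star> (g y + n x y + n y z + n x z) =
      g y \<star> g y + n x y \<star> n x y + n y z \<star> n y z + n x z \<star> n x z
      + (g y \<star> n x z + n x z \<star> g y) + (g y \<star> n x y + n x y \<star> g y) + (g y \<star> n y z + n y z \<star> g y)
      + (n x y \<star> n x z + n x z \<star> n x y) + (n y z \<star> n x z + n x z \<star> n y z)
      + (n x y \<star> n y z + n y z \<star> n x y)"
    by (simp only: mul_bilinear add_ac)
  ultimately have "g y + n x y + n y z + (n x y \<star> n y z + n y z \<star> n x y) = g y + n x y + n y z + n x z"
    using * X n_square[OF xy] n_square[OF yz] n_square[OF xz] by (simp only: g_mul if_True add_0_left add_0_right refl)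
  then show "n x y \<star> n y z + n y z \<star> n x y = n x z"
    by (simp only: add_left_cancel)
qed

lemma upE: "up x y \<Longrightarrow> \<exists>a. n x y = g x \<star> a \<star> g y"
  unfolding up_def by (rule exI, erule sym)

lemma downE: "down x y \<Longrightarrow> \<exists>a. n x y = g y \<star> a \<star> g x"
  unfolding down_def by (rule exI, erule sym)

text \<open>With opposite orientations both products of \<open>n x y\<close> and
  \<open>n y z\<close> vanish by orthogonality, although their sum is
  \<open>n x z \<noteq> 0\<close>.\<close>

lemma up_chain:
  assumes xy: "strict x y" and yz: "strict y z"
  shows "up x y \<longleftrightarrow> up y z"
proof -
  have X: "x \<in> X" "y \<in> X" "z \<in> X" and ne: "x \<noteq> y" "y \<noteq> z"
    using assms strict_X by (auto simp: strict_def)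
  have ne0: "n x y \<star> n y z + n y z \<star> n x y \<noteq> 0"
    using n_jordan_chain[OF xy yz] n_neq_0 by simp
  have "\<not> (up x y \<and> down y z)"
  proof
    assume "up x y \<and> down y z"
    then obtain a b where "n x y = g x \<star> a \<star> g y" "n y z = g z \<star> b \<star> g y"
      using upE downE by blast
    then show False
      using ne0 X ne by (simp add: mul_assoc g_mul_mul mul_bilinear)
  qed
  moreover have "\<not> (down x y \<and> up y z)"
  proof
    assume "down x y \<and> up y z"
    then obtain a b where "n x y = g y \<star> a \<star> g x" "n y z = g y \<star> b \<star> g z"
      using upE downE by blast
    then show False
      using ne0 X ne by (simp add: mul_assoc g_mul_mul mul_bilinear)
  qed
  ultimately show ?thesis
    using up_or_down[OF xy] up_or_down[OF yz] by blast
qed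

text \<open>If the second edge were down, \<open>n x y \<star> n x z\<close> would vanish but
  \<open>n x z \<star> n x y\<close> would not, by \<open>nondegenerate\<close> at the shared
  vertex. Yet these products sum to 0.\<close>

lemma up_fork:
  assumes xy: "strict x y" and xz: "strict x z" and up: "up x y"
  shows "up x z"
proof (rule ccontr)
  assume not_up: "\<not> up x z"
  then have "y \<noteq> z" using up by auto
  have X: "x \<in> X" "y \<in> X" "z \<in> X" and ne: "x \<noteq> y" "x \<noteq> z"
    using xy xz strict_X by (auto simp: strict_def)
  have down: "down x z" using up_or_down[OF xz] not_up by simp
  obtain a b where ab: "n x y = g x \<star> a \<star> g y" "n x z = g z \<star> b \<star> g x"
    using upE[OF up] downE[OF down] by blast
  have "n x z \<star> g x = n x z" "g x \<star> n x y = n x y"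
    using X unfolding ab by (simp_all add: mul_assoc g_mul g_mul_mul)
  then have "n x z \<star> g x \<star> n x y \<noteq> 0"
    using X xy xz n_neq_0[OF xy] n_neq_0[OF xz]
    by (intro nondegenerate) (auto simp: strict_def)
  moreover have "n x y \<star> n x z = 0"
    using X \<open>y \<noteq> z\<close> unfolding ab by (simp add: mul_assoc g_mul_mul mul_bilinear)
  ultimately show False
    using n_jordan_zero[OF xy xz] ne \<open>n x z \<star> g x = n x z\<close> by auto
qed

text \<open>The dual argument, with \<open>nondegenerate\<close> applied at the common upper vertex
  \<open>z\<close>.\<close>

lemma up_cofork:
  assumes xz: "strict x z" and yz: "strict y z" and up: "up x z"
  shows "up y z"
proof (rule ccontr)
  assume not_up: "\<not> up y z"
  then have "x \<noteq> y" using up by auto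
  have X: "x \<in> X" "y \<in> X" "z \<in> X" and ne: "x \<noteq> z" "y \<noteq> z"
    using xz yz strict_X by (auto simp: strict_def)
  have down: "down y z" using up_or_down[OF yz] not_up by simp
  obtain a b where ab: "n x z = g x \<star> a \<star> g z" "n y z = g z \<star> b \<star> g y"
    using upE[OF up] downE[OF down] by blast
  have "n x z \<star> g z = n x z" "g z \<star> n y z = n y z"
    using X unfolding ab by (simp_all add: mul_assoc g_mul g_mul_mul)
  then have "n x z \<star> g z \<star> n y z \<noteq> 0"
    using X xz yz n_neq_0[OF xz] n_neq_0[OF yz]
    by (intro nondegenerate) (auto simp: strict_def)
  moreover have "n y z \<star> n x z = 0"
    using X \<open>x \<noteq> y\<close> unfolding ab by (simp add: mul_assoc g_mul_mul mul_bilinear)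
  ultimately show False
    using n_jordan_zero[OF xz yz] ne \<open>n x z \<star> g z = n x z\<close> by auto
qed

lemma all_up_or_all_down:
  "(\<forall>x y. strict x y \<longrightarrow> up x y) \<or> (\<forall>x y. strict x y \<longrightarrow> down x y)"
proof (cases "\<exists>a b. strict a b \<and> up a b")
  case True
  then obtain a b where ab: "strict a b" "up a b" by blast
  \<comment> \<open>All edges at \<open>z\<close> are up. One up edge gives this at both of its
    endpoints, so it travels along any path of comparable elements starting at
    \<open>a\<close>.\<close>
  define Inc where "Inc z \<longleftrightarrow> (\<forall>u. (strict z u \<longrightarrow> up z u) \<and> (strict u z \<longrightarrow> up u z))" for z
  have Inc: "Inc x \<and> Inc y" if "strict x y" "up x y" for x y
    unfolding Inc_def
    using up_fork[OF that(1) _ that(2)] up_cofork[OF that(1) _ that(2)]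
      up_chain[OF that(1)] up_chain[OF _ that(1)] that(2) by auto
  have "Inc z" if "z \<in> X" for z
  proof -
    have "a \<in> X" using strict_X[OF ab(1)] ..
    then have "(a, z) \<in> (r \<union> r\<inverse>)\<^sup>*" using that by (rule connected)
    then show ?thesis
    proof (induction rule: rtrancl_induct)
      case base
      show ?case using Inc[OF ab] ..
    next
      case (step y z)
      then consider "y = z" | "strict y z" | "strict z y"
        by (auto simp: strict_def)
      then show ?case
      proof cases
        case 2
        then show ?thesis using Inc[of y z] step(3) by (simp add: Inc_def[of y])
      next
        case 3
        then show ?thesis using Inc[of z y] step(3) by (simp add: Inc_def[of y])
      qed (use step in simp)
    qed
  qed
  then show ?thesis
    unfolding Inc_def by (auto dest: strict_X)
next
  case False
  then show ?thesis using up_or_down by blast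
qed

section \<open>Multiplicativity or anti-multiplicativity\<close>

lemma phi_mul_basis_up:
  assumes up: "\<And>x y. strict x y \<Longrightarrow> up x y" and xy: "(x, y) \<in> r" and uw: "(u, w) \<in> r"
  shows "\<phi> (E x y \<star> E u w) = n x y \<star> n u w"
proof -
  have gng: "g x \<star> n x y \<star> g y = n x y" if "(x, y) \<in> r" for x y
  proof (cases "x = y")
    case True
    then show ?thesis using that r_X by (simp add: g_mul)
  next
    case False
    then show ?thesis using up[of x y] that by (simp add: strict_def up_def)
  qed
  have X: "x \<in> X" "y \<in> X" "u \<in> X" "w \<in> X" using xy uw r_X by auto
  obtain a b where ab: "n x y = g x \<star> a \<star> g y" "n u w = g u \<star> b \<star> g w"
    using gng[OF xy, symmetric] gng[OF uw, symmetric] by blast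
  consider "y \<noteq> u" | "x = y" "y = u" | "y = w" "y = u" | "strict x y" "strict y w" "y = u"
    using xy uw by (auto simp: strict_def)
  then show ?thesis
  proof cases
    case 1
    have "n x y \<star> n u w = 0"
      using X 1 unfolding ab by (simp add: mul_assoc g_mul_mul mul_bilinear)
    then show ?thesis using 1 xy uw by (simp add: mul_E_E phi_0)
  next
    case 2
    have "g u \<star> n u w = n u w" using X unfolding ab by (simp add: mul_assoc g_mul_mul)
    then show ?thesis using 2 xy uw by (simp add: mul_E_E)
  next
    case 3
    have "n x y \<star> g y = n x y" using X unfolding ab by (simp add: mul_assoc g_mul)
    then show ?thesis using 3 xy uw by (simp add: mul_E_E)
  next
    case 4
    \<comment> \<open>For a genuine chain the Jordan product is already known; orthogonality kills
      the wrong order and leaves the desired one.\<close>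
    have "x \<noteq> w" using n_jordan_chain(1)[OF 4(1,2)] by (simp add: strict_def)
    then have "n u w \<star> n x y = 0"
      using X unfolding ab by (simp add: mul_assoc g_mul_mul mul_bilinear)
    then show ?thesis using 4 xy uw n_jordan_chain(2)[OF 4(1,2)] by (simp add: mul_E_E)
  qed
qed

text \<open>The mirror image of the upward case: in a chain the product in the original order
  vanishes and the reversed one remains.\<close>

lemma phi_mul_basis_down:
  assumes down: "\<And>x y. strict x y \<Longrightarrow> down x y" and xy: "(x, y) \<in> r" and uw: "(u, w) \<in> r"
  shows "\<phi> (E x y \<star> E u w) = n u w \<star> n x y"
proof -
  have gng: "g y \<star> n x y \<star> g x = n x y" if "(x, y) \<in> r" for x y
  proof (cases "x = y")
    case True
    then show ?thesis using that r_X by (simp add: g_mul)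
  next
    case False
    then show ?thesis using down[of x y] that by (simp add: strict_def down_def)
  qed
  have X: "x \<in> X" "y \<in> X" "u \<in> X" "w \<in> X" using xy uw r_X by auto
  obtain a b where ab: "n x y = g y \<star> a \<star> g x" "n u w = g w \<star> b \<star> g u"
    using gng[OF xy, symmetric] gng[OF uw, symmetric] by blast
  consider "y \<noteq> u" | "x = y" "y = u" | "y = w" "y = u" | "strict x y" "strict y w" "y = u"
    using xy uw by (auto simp: strict_def)
  then show ?thesis
  proof cases
    case 1
    have "n u w \<star> n x y = 0"
      using X 1 unfolding ab by (simp add: mul_assoc g_mul_mul mul_bilinear)
    then show ?thesis using 1 xy uw by (simp add: mul_E_E phi_0)
  next
    case 2
    have "n u w \<star> g u = n u w" using X unfolding ab by (simp add: mul_assoc g_mul)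
    then show ?thesis using 2 xy uw by (simp add: mul_E_E)
  next
    case 3
    have "g y \<star> n x y = n x y" using X unfolding ab by (simp add: mul_assoc g_mul_mul)
    then show ?thesis using 3 xy uw by (simp add: mul_E_E)
  next
    case 4
    have "x \<noteq> w" using n_jordan_chain(1)[OF 4(1,2)] by (simp add: strict_def)
    then have "n x y \<star> n u w = 0"
      using X unfolding ab by (simp add: mul_assoc g_mul_mul mul_bilinear)
    then show ?thesis using 4 xy uw n_jordan_chain(2)[OF 4(1,2)] by (simp add: mul_E_E)
  qed
qed

text \<open>The parameter \<open>m\<close> stands for the product or its opposite. Both are
  bilinear, so one extension from the basis serves both orientations.\<close>

lemma phi_mul_extend:
  assumes m: "m = (\<star>) \<or> m = (\<lambda>a b. b \<star> a)"
    and basis: "\<And>x y u w. (x, y) \<in> r \<Longrightarrow> (u, w) \<in> r \<Longrightarrow> \<phi> (E x y \<star> E u w) = m (n x y) (n u w)"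
    and a: "a \<in> carr" and b: "b \<in> carr"
  shows "\<phi> (a \<star> b) = m (\<phi> a) (\<phi> b)"
proof -
  have bil: "m (p + q) s = m p s + m q s" "m s (p + q) = m s p + m s q" "m 0 s = 0" "m s 0 = 0"
    "m (smul c p) s = smul c (m p s)" "m s (smul c p) = smul c (m s p)" for p q s c
    using m by (auto simp: mul_bilinear)
  have "\<phi> (E x y \<star> b) = m (n x y) (\<phi> b)" if "(x, y) \<in> r" for x y
    using b
  proof (induction b rule: carr_induct)
    case zero
    show ?case unfolding phi_0 mul_bilinear bil ..
  next
    case (add a b)
    show ?case
      unfolding phi_add[OF add(1,2)] mul_bilinear bil add(3,4)[symmetric]
      by (rule phi_add) simp_all
  next
    case (E c u w)
    then show ?case using that by (simp add: mul_bilinear phi_smul bil basis)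
  qed
  note left = this
  show ?thesis
    using a
  proof (induction a rule: carr_induct)
    case zero
    show ?case unfolding phi_0 mul_bilinear bil ..
  next
    case (add a b)
    show ?case
      unfolding phi_add[OF add(1,2)] mul_bilinear bil add(3,4)[symmetric]
      by (rule phi_add) simp_all
  next
    case (E c u w)
    then show ?case by (simp add: mul_bilinear phi_smul bil left)
  qed
qed

lemma phi_mul_cases:
  "(\<forall>a\<in>carr. \<forall>b\<in>carr. \<phi> (a \<star> b) = \<phi> a \<star> \<phi> b) \<or>
   (\<forall>a\<in>carr. \<forall>b\<in>carr. \<phi> (a \<star> b) = \<phi> b \<star> \<phi> a)"
  using all_up_or_all_down
proof
  assume "\<forall>x y. strict x y \<longrightarrow> up x y"
  then show ?thesis
    using phi_mul_extend[of "(\<star>)"] phi_mul_basis_up by blast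
next
  assume "\<forall>x y. strict x y \<longrightarrow> down x y"
  then show ?thesis
    using phi_mul_extend[of "\<lambda>a b. b \<star> a"] phi_mul_basis_down by blast
qed

lemma automorphism_or_antiautomorphism:
  "algebra_automorphism (incidence_algebra X r) \<phi> \<or> algebra_antiautomorphism (incidence_algebra X r) \<phi>"
  using phi_mul_cases phi_inj phi_surj
  by (auto simp: algebra_automorphism_def algebra_antiautomorphism_def linear_endo_iff ring_iso_def
      ring_hom_def bij_betw_def incidence_algebra_simps unital phi_add phi_smul)

end

section \<open>Reduction of the equivalence to unital maps\<close>

theorem corollary2p27:
  fixes X :: "'a set" and r :: "'a rel"
    and A :: "('k::field, 'a \<Rightarrow> 'a \<Rightarrow> 'k) module"
    and \<phi> :: "('a \<Rightarrow> 'a \<Rightarrow> 'k) \<Rightarrow> 'a \<Rightarrow> 'a \<Rightarrow> 'k"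
  defines "A \<equiv> incidence_algebra X r"
  assumes "finite X" and "connected_poset X r" and "CHAR('k) \<noteq> 2"
    and "\<phi> \<in> carrier A \<rightarrow> carrier A"
  shows "bij_betw \<phi> (carrier A) (carrier A) \<and> linear_endo A \<phi> \<and> inverse_preserver A \<phi> \<longleftrightarrow>
    (\<exists>\<psi> \<in> {\<phi>, \<lambda>a. \<ominus>\<^bsub>A\<^esub> \<phi> a}. algebra_automorphism A \<psi> \<or> algebra_antiautomorphism A \<psi>)"
proof -
  interpret finite_poset X r
    using assms by unfold_locales (auto simp: connected_poset_def)
  let ?blip = "bijective_linear_inverse_preserver :: (('a \<Rightarrow> 'a \<Rightarrow> 'k) \<Rightarrow> 'a \<Rightarrow> 'a \<Rightarrow> 'k) \<Rightarrow> bool"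
  let ?aut = "\<lambda>\<psi>. algebra_automorphism A \<psi> \<or> algebra_antiautomorphism A \<psi>"
  have \<phi>: "\<phi> \<in> carr \<rightarrow> carr"
    using assms by (simp add: incidence_algebra_simps)
  define \<phi>' where "\<phi>' = (\<lambda>a. \<ominus>\<^bsub>A\<^esub> \<phi> a)"
  have \<phi>': "\<phi>' a = - \<phi> a" "\<phi> a = - \<phi>' a" if "a \<in> carr" for a
    using a_inv_eq_uminus[OF Pi_mem[OF \<phi> that]] by (simp_all add: \<phi>'_def A_def)
  \<comment> \<open>A characteristic dividing 2 is 1 or 2, and 1 is impossible in a field.\<close>
  have "\<not> CHAR('k) dvd 2"
  proof
    assume dvd: "CHAR('k) dvd 2"
    then have "CHAR('k) \<le> 2" "CHAR('k) > 0"
      by (simp_all add: dvd_imp_le dvd_pos_nat[OF _ dvd])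
    then show False
      using \<open>CHAR('k) \<noteq> 2\<close> CHAR_not_1[where 'a = 'k] by linarith
  qed
  then have two: "(2::'k) \<noteq> 0"
    using of_nat_eq_0_iff_char_dvd[of 2, where 'a = 'k] by simp
  have preserving: "inverse_preserving X r \<psi>" if "?blip \<psi>" for \<psi>
  proof -
    have \<psi>: "\<psi> \<in> carr \<rightarrow> carr"
      using that by (simp add: bijective_linear_inverse_preserver_def linear_endo_iff)
    show ?thesis
      using that \<psi> two \<open>connected_poset X r\<close>
      unfolding bijective_linear_inverse_preserver_def inverse_preserver_iff[OF \<psi>] linear_endo_iff
      by unfold_locales (auto simp: connected_poset_def bij_betw_def)
  qed
  have unital: "?aut \<psi>" if "?blip \<psi>" "\<psi> delta = delta" for \<psi>
  proof -
    interpret inverse_preserving X r \<psi> by (rule preserving[OF that(1)])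
    interpret unital_inverse_preserving X r \<psi> by unfold_locales (rule that(2))
    show ?thesis using automorphism_or_antiautomorphism by (simp add: A_def)
  qed
  have "?blip \<phi> \<longleftrightarrow> ?aut \<phi> \<or> ?aut \<phi>'"
  proof
    assume blip: "?blip \<phi>"
    then have "?blip \<phi>'"
      by (rule bijective_linear_inverse_preserver_uminus) (rule \<phi>')
    moreover have "\<phi> delta = delta \<or> \<phi> delta = - delta"
      using inverse_preserving.v_cases[OF preserving[OF blip]] .
    \<comment> \<open>One of the two candidate maps is unital, so the unital case applies to
      it.\<close>
    then have "\<phi> delta = delta \<or> \<phi>' delta = delta"
      using \<phi>'(1)[of delta] by auto
    ultimately show "?aut \<phi> \<or> ?aut \<phi>'"
      using unital blip by blast
  next
    assume "?aut \<phi> \<or> ?aut \<phi>'"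
    then have "?blip \<phi> \<or> ?blip \<phi>'"
      unfolding A_def using bijective_linear_inverse_preserver_if by blast
    then show "?blip \<phi>"
      using bijective_linear_inverse_preserver_uminus[of \<phi>' \<phi>] \<phi>' by blast
  qed
  then show ?thesis
    unfolding \<phi>'_def[symmetric] bijective_linear_inverse_preserver_def
    by (simp add: A_def incidence_algebra_simps)
qed

end
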